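(* Let $n\ge 2$ and $k\ge1$. With the crystal operators $e_i,f_i$ and K-crystal operators $e_i^K,f_i^K$ ($1\le i<n$) below, $\mathrm{SVT}^n((k))$ is a K-crystal, i.e.: (K.1) the graph on $\mathrm{SVT}^n((k))$ with edges $T\to f_iT$ and $T\to f_i^KT$ (nonzero) is connected, and $u$ is the only element with $e_iu=0$ and $e_i^Ku=0$ for all $i$; (K.2) for every $w\in S_n$ the set $\mathrm{SVT}^n_w(k\Lambda_1)$ does not depend on the choice of reduced expression of $w$; (K.3) for every $w\in S_n$ with reduced expression $w=s_{i_1}\cdots s_{i_\ell}$, \[\sum_{T\in\mathrm{SVT}^n_w(k\Lambda_1)}\beta^{\mathrm{ex}(T)}x^{\mathrm{wt}(T)}=\varpi_{i_1}\cdots\varpi_{i_\ell}\,x_1^k,\] the Lascoux polynomial $L_{w\lambda}$ for $\lambda=(k,0,\dots,0)$.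
   Context: $\mathrm{SVT}^n((k))$: sequences of nonempty sets $A_1,\dots,A_k\subseteq\{1,\dots,n\}$ with $\max A_j\le\min A_{j+1}$ ($1\times k$ semistandard set-valued tableaux). $\mathrm{wt}(T)=(c_1,\dots,c_n)$ with $c_j$ the number of boxes containing $j$; $\mathrm{ex}(T)=\sum_j(|A_j|-1)$. $u$ is the row with all boxes $\{1\}$. Crystal operators ($1\le i<n$): write $+$ above each box containing $i$ but not $i+1$ and $-$ above each box containing $i+1$ but not $i$; reading left to right, repeatedly delete adjacent pairs $-+$. If no $+$ remains, $f_iT=0$; otherwise let $\mathsf b$ be the box of the rightmost remaining $+$ and $\mathsf b^\rightarrow$ the next box; if $i\notin\mathsf b^\rightarrow$, $f_iT$ replaces $i$ by $i+1$ in $\mathsf b$, else removes $i$ from $\mathsf b^\rightarrow$ and adds $i+1$ to $\mathsf b$. If no $-$ remains, $e_iT=0$; otherwise let $\mathsf b$ be the box of the leftmost remaining $-$ and $\mathsf b^\leftarrow$ the previous box; if $i+1\notin\mathsf b^\leftarrow$, $e_iT$ replaces $i+1$ by $i$ in $\mathsf b$, else removes $i+1$ from $\mathsf b^\leftarrow$ and adds $i$ to $\mathsf b$. K-crystal operators: $f_i^KT=0$ if $i\notin T$ or $i+1\in T$; otherwise $f_i^KT$ adds $i+1$ to the rightmost box containing $i$. $e_i^KT=0$ if no box contains both $i$ and $i+1$; otherwise $e_i^KT$ deletes $i+1$ from that box. For $g\in\{e_i,e_i^K\}$, $g^{\max}T=g^rT$ with $r$ maximal such that $g^rT\ne0$.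 K-Demazure crystal for a reduced expression $w=s_{i_1}\cdots s_{i_\ell}$: $\mathrm{SVT}^n_w(k\Lambda_1)=\{T : (e^K_{i_\ell})^{\max}e_{i_\ell}^{\max}\cdots(e^K_{i_1})^{\max}e_{i_1}^{\max}T=u\}$ (rightmost operator applied first). Demazure--Lascoux operators on $\mathbb Z[\beta][x_1,\dots,x_n]$: $\partial_if=(f-s_if)/(x_i-x_{i+1})$ with $s_i$ swapping $x_i,x_{i+1}$, and $\varpi_if=\partial_i\big((x_i+\beta x_ix_{i+1})f\big)$. *)

theory Defs
  imports
    "HOL-Library.Poly_Mapping"
    "HOL-Computational_Algebra.Polynomial"
    "HOL-Combinatorics.Permutations"
begin

section \<open>Row-shaped set-valued tableaux\<close>

text \<open>A tableau is the list of its boxes, read from left to right.  Boxes are numbered from 0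
  (list positions); entries, simple reflections and variables are numbered from 1.\<close>

type_synonym tableau = "nat set list"

definition SVT :: "nat \<Rightarrow> nat \<Rightarrow> tableau set" where
  "SVT n k = {T. length T = k \<and>
                 (\<forall>j<k. T ! j \<noteq> {} \<and> T ! j \<subseteq> {1..n}) \<and>
                 (\<forall>j. Suc j < k \<longrightarrow> Max (T ! j) \<le> Min (T ! Suc j))}"

definition wt :: "tableau \<Rightarrow> nat \<Rightarrow> nat" where
  "wt T j = card {b. b < length T \<and> j \<in> T ! b}"

definition ex :: "tableau \<Rightarrow> nat" where
  "ex T = (\<Sum>A\<leftarrow>T. card A - 1)"

definition u_row :: "nat \<Rightarrow> tableau" where
  "u_row k = replicate k {1}"


section \<open>Signatures\<close>

datatype sign = SPlus | SMinus

text \<open>Every sign is paired with the position of the box above which it is written.\<close>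

definition signature :: "nat \<Rightarrow> tableau \<Rightarrow> (sign \<times> nat) list" where
  "signature i T = concat (map (\<lambda>b.
     if i \<in> T ! b \<and> Suc i \<notin> T ! b then [(SPlus, b)]
     else if Suc i \<in> T ! b \<and> i \<notin> T ! b then [(SMinus, b)]
     else []) [0..<length T])"

inductive delete_pair :: "(sign \<times> nat) list \<Rightarrow> (sign \<times> nat) list \<Rightarrow> bool" where
  "delete_pair (xs @ (SMinus, a) # (SPlus, b) # ys) (xs @ ys)"

text \<open>The result of repeatedly deleting adjacent pairs \<open>-+\<close>, computed from the right end of the
  word; \<open>reduced_signature_iff\<close> below shows that it is the unique irreducible word reachable by
  \<open>delete_pair\<close> steps.\<close>

fun reduce_signature :: "(sign \<times> nat) list \<Rightarrow> (sign \<times> nat) list" where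
  "reduce_signature [] = []"
| "reduce_signature (x # xs) =
     (case reduce_signature xs of
        [] \<Rightarrow> [x]
      | y # ys \<Rightarrow> if fst x = SMinus \<and> fst y = SPlus then ys else x # y # ys)"

lemma delete_pair_Cons: "delete_pair xs ys \<Longrightarrow> delete_pair (x # xs) (x # ys)"
  by (metis Cons_eq_appendI delete_pair.simps)

lemma delete_pairs_Cons: "delete_pair\<^sup>*\<^sup>* xs ys \<Longrightarrow> delete_pair\<^sup>*\<^sup>* (x # xs) (x # ys)"
  by (induction rule: rtranclp_induct) (auto intro: rtranclp.rtrancl_into_rtrancl delete_pair_Cons)

lemma delete_pairs_reduce_signature: "delete_pair\<^sup>*\<^sup>* xs (reduce_signature xs)"
proof (induction xs)
  case (Cons x xs)
  have step: "delete_pair\<^sup>*\<^sup>* (x # xs) (x # reduce_signature xs)"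
    using Cons delete_pairs_Cons by blast
  show ?case
  proof (cases "reduce_signature xs")
    case (Cons y ys)
    show ?thesis
    proof (cases "fst x = SMinus \<and> fst y = SPlus")
      case True
      then have "delete_pair (x # y # ys) ys"
        using delete_pair.intros[of "[]" "snd x" "snd y" ys] by (metis append_Nil prod.collapse)
      with step Cons True show ?thesis by auto
    qed (use step Cons in auto)
  qed (use step in auto)
qed auto

lemma reduce_signature_step: "delete_pair xs ys \<Longrightarrow> reduce_signature xs = reduce_signature ys"
proof (induction rule: delete_pair.induct)
  case (1 xs a b ys)
  show ?case
    by (induction xs) (auto split: list.splits)
qed

lemma reduce_signature_irreducible: "(\<nexists>ys. delete_pair xs ys) \<Longrightarrow> reduce_signature xs = xs"
  by (metis converse_rtranclpE delete_pairs_reduce_signature)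

lemma reduce_signature_normal: "\<not> delete_pair (reduce_signature xs) ys"
proof -
  have sorted: "sorted_wrt (\<lambda>x y. \<not> (fst x = SMinus \<and> fst y = SPlus)) (reduce_signature zs)" for zs
  proof (induction zs)
    case (Cons z zs)
    show ?case
    proof (cases "reduce_signature zs")
      case (Cons y ys)
      show ?thesis
      proof (cases "fst z = SMinus \<and> fst y = SPlus")
        case True
        then show ?thesis using Cons.IH Cons by simp
      next
        case False
        then have "fst z = SPlus \<or> fst y = SMinus"
          using sign.exhaust by blast
        then show ?thesis using Cons.IH Cons False by auto
      qed
    qed simp
  qed simp
  show ?thesis
  proof
    assume "delete_pair (reduce_signature xs) ys"
    then show False using sorted[of xs]
      by (cases) (auto simp: sorted_wrt_append)
  qed
qed

lemma reduced_signature_iff: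
  "delete_pair\<^sup>*\<^sup>* xs ys \<and> (\<nexists>zs. delete_pair ys zs) \<longleftrightarrow> ys = reduce_signature xs"
proof -
  have "reduce_signature xs = reduce_signature ys" if "delete_pair\<^sup>*\<^sup>* xs ys"
    using that by (induction rule: rtranclp_induct) (auto dest: reduce_signature_step)
  then show ?thesis
    using delete_pairs_reduce_signature reduce_signature_normal reduce_signature_irreducible
    by metis
qed

definition remaining :: "sign \<Rightarrow> nat \<Rightarrow> tableau \<Rightarrow> nat list" where
  "remaining s i T = map snd (filter (\<lambda>p. fst p = s) (reduce_signature (signature i T)))"


section \<open>Crystal and K-crystal operators\<close>

text \<open>The value \<open>None\<close> stands for the result 0.  If the box carrying the sign is the last (for
  \<open>f_op\<close>) or the first (for \<open>e_op\<close>) one, the neighbouring box does not exist and the operator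
  changes the entry inside that single box.\<close>

definition f_op :: "nat \<Rightarrow> tableau \<Rightarrow> tableau option" where
  "f_op i T =
     (if remaining SPlus i T = [] then None
      else let b = last (remaining SPlus i T) in
        if Suc b < length T \<and> i \<in> T ! Suc b
        then Some (T[Suc b := T ! Suc b - {i}, b := insert (Suc i) (T ! b)])
        else Some (T[b := insert (Suc i) (T ! b - {i})]))"

definition e_op :: "nat \<Rightarrow> tableau \<Rightarrow> tableau option" where
  "e_op i T =
     (if remaining SMinus i T = [] then None
      else let b = hd (remaining SMinus i T) in
        if 0 < b \<and> Suc i \<in> T ! (b - 1)
        then Some (T[b - 1 := T ! (b - 1) - {Suc i}, b := insert i (T ! b)])
        else Some (T[b := insert i (T ! b - {Suc i})]))"

definition fK_op :: "nat \<Rightarrow> tableau \<Rightarrow> tableau option" where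
  "fK_op i T =
     (if (\<forall>A\<in>set T. i \<notin> A) \<or> (\<exists>A\<in>set T. Suc i \<in> A) then None
      else let b = Max {b. b < length T \<and> i \<in> T ! b} in
        Some (T[b := insert (Suc i) (T ! b)]))"

text \<open>A tableau in \<open>SVT n k\<close> has at most one box containing both \<open>i\<close> and \<open>i + 1\<close>.\<close>

definition eK_op :: "nat \<Rightarrow> tableau \<Rightarrow> tableau option" where
  "eK_op i T =
     (if (\<forall>A\<in>set T. \<not> (i \<in> A \<and> Suc i \<in> A)) then None
      else let b = (THE b. b < length T \<and> i \<in> T ! b \<and> Suc i \<in> T ! b) in
        Some (T[b := T ! b - {Suc i}]))"

definition crystal_edges :: "nat \<Rightarrow> nat \<Rightarrow> (tableau \<times> tableau) set" where
  "crystal_edges n k =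
     {(T, T'). T \<in> SVT n k \<and> T' \<in> SVT n k \<and>
        (\<exists>i\<in>{1..<n}. f_op i T = Some T' \<or> fK_op i T = Some T')}"

primrec op_pow :: "(tableau \<Rightarrow> tableau option) \<Rightarrow> nat \<Rightarrow> tableau \<Rightarrow> tableau option" where
  "op_pow g 0 T = Some T"
| "op_pow g (Suc r) T = Option.bind (op_pow g r T) g"

definition op_max :: "(tableau \<Rightarrow> tableau option) \<Rightarrow> tableau \<Rightarrow> tableau" where
  "op_max g T = the (op_pow g (GREATEST r. op_pow g r T \<noteq> None) T)"


section \<open>Reduced expressions and K-Demazure crystals\<close>

text \<open>The word \<open>[i\<^sub>1, \<dots>, i\<^sub>l]\<close> stands for the product \<open>s\<^sub>i\<^sub>1 \<cdots> s\<^sub>i\<^sub>l\<close> of simple transpositions.\<close>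

definition word_perm :: "nat list \<Rightarrow> nat \<Rightarrow> nat" where
  "word_perm ws = foldr (\<lambda>i w. transpose i (Suc i) \<circ> w) ws id"

definition reduced_expr :: "nat \<Rightarrow> (nat \<Rightarrow> nat) \<Rightarrow> nat list \<Rightarrow> bool" where
  "reduced_expr n w ws \<longleftrightarrow>
     set ws \<subseteq> {1..<n} \<and> word_perm ws = w \<and>
     (\<forall>vs. set vs \<subseteq> {1..<n} \<and> word_perm vs = w \<longrightarrow> length ws \<le> length vs)"

text \<open>\<open>fold\<close> applies the operators for the first letter of the word first.\<close>

definition K_Demazure :: "nat \<Rightarrow> nat \<Rightarrow> nat list \<Rightarrow> tableau set" where
  "K_Demazure n k ws =
     {T \<in> SVT n k. fold (\<lambda>i S. op_max (eK_op i) (op_max (e_op i) S)) ws T = u_row k}"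


section \<open>Demazure--Lascoux operators\<close>

text \<open>Polynomials over \<open>\<int>[\<beta>]\<close>, with finitely supported exponent vectors as monomials.  The
  variables are \<open>X 0, X 1, X 2, \<dots>\<close>; the ring \<open>\<int>[\<beta>][x\<^sub>1, \<dots>, x\<^sub>n]\<close> is the subring of polynomials
  in \<open>X 1, \<dots>, X n\<close>, and it is stable under the operators below for \<open>1 \<le> i < n\<close>.\<close>

type_synonym mpoly = "(nat \<Rightarrow>\<^sub>0 nat) \<Rightarrow>\<^sub>0 int poly"

definition X :: "nat \<Rightarrow> mpoly" where
  "X i = Poly_Mapping.single (Poly_Mapping.single i 1) 1"

definition beta :: mpoly where
  "beta = Poly_Mapping.single 0 [:0, 1:]"

definition swap_vars :: "nat \<Rightarrow> mpoly \<Rightarrow> mpoly" where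
  "swap_vars i f = Poly_Mapping.map_key (Poly_Mapping.map_key (transpose i (Suc i))) f"

text \<open>\<open>mpoly\<close> is an integral domain, so the quotient is unique; it exists because
  \<open>f - swap_vars i f\<close> vanishes when \<open>X i\<close> and \<open>X (i + 1)\<close> are identified.\<close>

definition divdiff :: "nat \<Rightarrow> mpoly \<Rightarrow> mpoly" where
  "divdiff i f = (THE g. (X i - X (Suc i)) * g = f - swap_vars i f)"

definition varpi :: "nat \<Rightarrow> mpoly \<Rightarrow> mpoly" where
  "varpi i f = divdiff i ((X i + beta * X i * X (Suc i)) * f)"

definition tableau_monomial :: "nat \<Rightarrow> tableau \<Rightarrow> mpoly" where
  "tableau_monomial n T = beta ^ ex T * (\<Prod>j=1..n. X j ^ wt T j)"

end

theory Submission
  imports Defs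
begin

text \<open>In a row every box containing \<open>i\<close> lies weakly to the left of every box containing \<open>i + 1\<close>, so
  the \<open>i\<close>-signature is already reduced and an \<open>i\<close>-string, extended by the K-operators, runs through
  all fillings of a fixed block of boxes by \<open>i, \<dots>, i\<close>, at most one \<open>{i, i + 1}\<close>, and
  \<open>i + 1, \<dots>, i + 1\<close>.  Hence \<open>e\<^sub>i\<close> and \<open>e\<^sub>i\<^sup>K\<close> applied maximally just replace \<open>i + 1\<close> by \<open>i\<close> in every
  box, and the K-Demazure crystal of \<open>w\<close> consists of all rows with entries at most \<open>w(1)\<close>.  The
  generating function of a string through \<open>t\<close> boxes is
  \<open>h\<^sub>t + \<beta> x\<^sub>i x\<^sub>i\<^sub>+\<^sub>1 h\<^sub>t\<^sub>-\<^sub>1 = \<varpi>\<^sub>i x\<^sub>i\<^sup>t\<close>, which is symmetric in \<open>x\<^sub>i, x\<^sub>i\<^sub>+\<^sub>1\<close>; summing over strings shows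
  that \<open>\<varpi>\<^sub>i\<close> maps the generating function of rows with entries at most \<open>m\<close> to itself if \<open>i \<noteq> m\<close>, and
  to that of rows with entries at most \<open>m + 1\<close> if \<open>i = m\<close>.\<close>

section \<open>Demazure--Lascoux operators\<close>

lemma map_key_transpose_involutory [simp]:
  "Poly_Mapping.map_key (transpose a b) (Poly_Mapping.map_key (transpose a b) p) = p"
  by (simp add: map_key_compose comp_def map_key_id)

lemma inj_map_key_transpose: "inj (Poly_Mapping.map_key (transpose a b))"
  by (rule inj_on_inverseI[where g = "Poly_Mapping.map_key (transpose a b)"]) simp

lemma swap_vars_add: "swap_vars i (f + g) = swap_vars i f + swap_vars i g"
  by (simp add: swap_vars_def map_key_plus inj_map_key_transpose)

lemma swap_vars_zero [simp]: "swap_vars i 0 = 0"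
  by (simp add: swap_vars_def inj_map_key_transpose)

lemma swap_vars_sum: "swap_vars i (sum f A) = (\<Sum>a\<in>A. swap_vars i (f a))"
  by (induction A rule: infinite_finite_induct) (auto simp: swap_vars_add)

lemma swap_vars_single:
  "swap_vars i (Poly_Mapping.single m c) =
   Poly_Mapping.single (Poly_Mapping.map_key (transpose i (Suc i)) m) c"
  using map_key_single[OF inj_map_key_transpose[of i "Suc i"],
      of "Poly_Mapping.map_key (transpose i (Suc i)) m" c]
  by (simp add: swap_vars_def)

text \<open>Updating outside the support amounts to adding a monomial, so additive statements only
  need to be followed through the addition of one monomial.\<close>

lemma poly_mapping_single_induct [case_names zero add]:
  assumes "P 0" and "\<And>f m c. P f \<Longrightarrow> P (f + Poly_Mapping.single m c)"
  shows "P f"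
proof (induction f rule: update_induct)
  case const
  then show ?case by (simp add: assms)
next
  case (update f a b)
  have "Poly_Mapping.update a b f = f + Poly_Mapping.single a b"
    using update.hyps
    by (intro poly_mapping_eqI) (auto simp: lookup_update lookup_add lookup_single when_def in_keys_iff)
  then show ?case using assms update by simp
qed

lemma swap_vars_mult_single:
  "swap_vars i (f * Poly_Mapping.single m c) = swap_vars i f * swap_vars i (Poly_Mapping.single m c)"
  by (induction f rule: poly_mapping_single_induct)
    (auto simp: distrib_right swap_vars_add swap_vars_single mult_single map_key_plus)

lemma swap_vars_mult: "swap_vars i (f * g) = swap_vars i f * swap_vars i g"
  by (induction g rule: poly_mapping_single_induct)
    (auto simp: distrib_left swap_vars_add swap_vars_mult_single)

lemma swap_vars_one [simp]: "swap_vars i 1 = 1"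
  by (simp add: swap_vars_single flip: single_one)

lemma swap_vars_power: "swap_vars i (f ^ m) = swap_vars i f ^ m"
  by (induction m) (auto simp: swap_vars_mult)

lemma swap_vars_prod: "swap_vars i (prod f A) = (\<Prod>a\<in>A. swap_vars i (f a))"
  by (induction A rule: infinite_finite_induct) (auto simp: swap_vars_mult)

lemma swap_vars_beta [simp]: "swap_vars i beta = beta"
  by (simp add: beta_def swap_vars_single)

lemma swap_vars_X: "swap_vars i (X j) = X (transpose i (Suc i) j)"
proof -
  have "Poly_Mapping.map_key (transpose i (Suc i)) (Poly_Mapping.single j (1::nat)) =
        Poly_Mapping.single (transpose i (Suc i) j) 1"
    using map_key_single[of "transpose i (Suc i)" "transpose i (Suc i) j" "1::nat"] by simp
  then show ?thesis by (simp add: X_def swap_vars_single)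
qed

lemma X_eq_iff: "X i = X j \<longleftrightarrow> i = j"
proof
  assume "X i = X j"
  then have "Poly_Mapping.keys (X i) = Poly_Mapping.keys (X j)" by simp
  then have "Poly_Mapping.single i (1::nat) = Poly_Mapping.single j 1" by (simp add: X_def)
  then have "Poly_Mapping.keys (Poly_Mapping.single i (1::nat)) = Poly_Mapping.keys (Poly_Mapping.single j (1::nat))"
    by simp
  then show "i = j" by simp
qed simp

text \<open>\<open>varpi_rel i f g\<close> is the equation characterising \<open>g = varpi i f\<close>; unlike \<open>varpi\<close> itself it is
  visibly linear, since \<open>divdiff\<close> is only a definite description.\<close>

definition varpi_rel :: "nat \<Rightarrow> mpoly \<Rightarrow> mpoly \<Rightarrow> bool" where
  "varpi_rel i f g \<longleftrightarrow> (X i - X (Suc i)) * g =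
     (X i + beta * X i * X (Suc i)) * f - (X (Suc i) + beta * X i * X (Suc i)) * swap_vars i f"

text \<open>The factor \<open>X i - X (Suc i)\<close> is nonzero and can be cancelled, so a solution
  of \<open>varpi_rel\<close> is the unique quotient described by \<open>divdiff\<close>; exhibiting
  one also settles existence.\<close>

lemma varpi_eqI: "varpi_rel i f g \<Longrightarrow> varpi i f = g"
proof -
  assume "varpi_rel i f g"
  then have g: "(X i - X (Suc i)) * g = (X i + beta * X i * X (Suc i)) * f -
      swap_vars i ((X i + beta * X i * X (Suc i)) * f)"
    unfolding varpi_rel_def swap_vars_mult swap_vars_add swap_vars_X swap_vars_beta
      transpose_apply_first transpose_apply_second by (simp only: mult_ac)
  have "X i - X (Suc i) \<noteq> 0" by (simp add: X_eq_iff)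
  then have "h = g" if "(X i - X (Suc i)) * h = (X i - X (Suc i)) * g" for h
    using that mult_cancel_left by blast
  then show ?thesis unfolding varpi_def divdiff_def g[symmetric]
    by (intro the_equality) simp_all
qed

lemma varpi_rel_sum:
  assumes "\<And>a. a \<in> A \<Longrightarrow> varpi_rel i (f a) (g a)"
  shows "varpi_rel i (sum f A) (sum g A)"
  unfolding varpi_rel_def sum_distrib_left swap_vars_sum sum_subtractf[symmetric]
  using assms by (intro sum.cong) (auto simp only: varpi_rel_def)

lemma varpi_rel_self: "swap_vars i f = f \<Longrightarrow> varpi_rel i f f"
  unfolding varpi_rel_def by (simp only: distrib_right left_diff_distrib add_diff_cancel_right)

lemma varpi_rel_mult:
  assumes c: "swap_vars i c = c" and fg: "varpi_rel i f g"
  shows "varpi_rel i (c * f) (c * g)"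
proof -
  have "(X i - X (Suc i)) * (c * g) = c * ((X i - X (Suc i)) * g)"
    by (simp only: mult_ac)
  also have "\<dots> = c * ((X i + beta * X i * X (Suc i)) * f -
      (X (Suc i) + beta * X i * X (Suc i)) * swap_vars i f)"
    using fg by (simp only: varpi_rel_def)
  also have "\<dots> = (X i + beta * X i * X (Suc i)) * (c * f) -
      (X (Suc i) + beta * X i * X (Suc i)) * swap_vars i (c * f)"
    unfolding swap_vars_mult c by (simp only: right_diff_distrib mult_ac)
  finally show ?thesis unfolding varpi_rel_def .
qed

text \<open>This is h_t + \<beta> x y h_(t-1) in x = \<open>X i\<close>, y =
  \<open>X (Suc i)\<close>. The terms of the two sums correspond to the fillings of t boxes without
  and with a box {i, i + 1}.\<close>

definition string_poly :: "nat \<Rightarrow> nat \<Rightarrow> mpoly" where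
  "string_poly i t = (\<Sum>a\<le>t. X i ^ a * X (Suc i) ^ (t - a)) +
     beta * (\<Sum>a<t. X i ^ Suc a * X (Suc i) ^ (t - a))"

lemma varpi_rel_power: "varpi_rel i (X i ^ t) (string_poly i t)"
proof -
  let ?x = "X i" and ?y = "X (Suc i)"
  have 1: "(?x - ?y) * (\<Sum>a\<le>t. ?x ^ a * ?y ^ (t - a)) = ?x ^ Suc t - ?y ^ Suc t"
    using diff_power_eq_sum[of ?x t ?y] by (simp add: lessThan_Suc_atMost)
  have "(?x - ?y) * (\<Sum>a<t. ?x ^ Suc a * ?y ^ (t - a)) = ?x * ?y * (?x ^ t - ?y ^ t)"
  \<comment> \<open>For t = 0 both sides vanish. Otherwise x y factors out and h_(t-1)
    telescopes.\<close>
  proof (cases t)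
    case (Suc s)
    have "(\<Sum>a<t. ?x ^ Suc a * ?y ^ (t - a)) = ?x * ?y * (\<Sum>a<t. ?x ^ a * ?y ^ (s - a))"
      unfolding sum_distrib_left using Suc by (intro sum.cong) (auto simp: Suc_diff_le)
    then show ?thesis using diff_power_eq_sum[of ?x s ?y] Suc by (simp add: mult_ac)
  qed simp
  with 1 have "(?x - ?y) * string_poly i t =
      ?x ^ Suc t - ?y ^ Suc t + beta * (?x * ?y * (?x ^ t - ?y ^ t))"
    unfolding string_poly_def distrib_left by (simp only: mult.left_commute[of _ beta])
  also have "\<dots> = (?x + beta * ?x * ?y) * ?x ^ t - (?y + beta * ?x * ?y) * ?y ^ t"
    by (simp only: algebra_simps power_Suc)
  finally show ?thesis
    unfolding varpi_rel_def swap_vars_power swap_vars_X by simp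
qed

text \<open>Reversing the summation order exchanges the variables. In the second sum both exponents
  run from 1 to t, so the reversal is a -> t - 1 - a.\<close>

lemma swap_string_poly: "swap_vars i (string_poly i t) = string_poly i t"
proof -
  have 1: "(\<Sum>a\<le>t. X (Suc i) ^ a * X i ^ (t - a)) = (\<Sum>a\<le>t. X i ^ a * X (Suc i) ^ (t - a))"
    by (rule sum.reindex_bij_witness[of _ "\<lambda>a. t - a" "\<lambda>a. t - a"]) (auto simp: mult.commute)
  have 2: "(\<Sum>a<t. X (Suc i) ^ Suc a * X i ^ (t - a)) = (\<Sum>a<t. X i ^ Suc a * X (Suc i) ^ (t - a))"
    by (rule sum.reindex_bij_witness[of _ "\<lambda>a. t - Suc a" "\<lambda>a. t - Suc a"])
      (auto simp: mult.commute Suc_diff_Suc simp del: power_Suc)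
  show ?thesis
    unfolding string_poly_def swap_vars_add swap_vars_mult swap_vars_sum swap_vars_power swap_vars_X
      swap_vars_beta transpose_apply_first transpose_apply_second 1 2 ..
qed

section \<open>Rows\<close>

text \<open>Boxes are nonempty, so an entry of each intermediate box carries the adjacent inequality
  on to distant boxes. The resulting form mentions entries only, without \<open>Max\<close> and
  \<open>Min\<close>.\<close>

lemma SVT_iff:
  "T \<in> SVT n k \<longleftrightarrow> length T = k \<and> (\<forall>b<k. T ! b \<noteq> {} \<and> T ! b \<subseteq> {1..n}) \<and>
     (\<forall>a b x y. a < b \<longrightarrow> b < k \<longrightarrow> x \<in> T ! a \<longrightarrow> y \<in> T ! b \<longrightarrow> x \<le> y)"
proof -
  have "(\<forall>j. Suc j < k \<longrightarrow> Max (T ! j) \<le> Min (T ! Suc j)) \<longleftrightarrow>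
        (\<forall>a b x y. a < b \<longrightarrow> b < k \<longrightarrow> x \<in> T ! a \<longrightarrow> y \<in> T ! b \<longrightarrow> x \<le> y)"
    if T: "\<forall>b<k. T ! b \<noteq> {} \<and> T ! b \<subseteq> {1..n}"
  proof -
    have fin: "finite (T ! b)" if "b < k" for b
      using T that finite_subset[of _ "{1..n}"] by blast
    have adjacent: "Max (T ! j) \<le> Min (T ! Suc j) \<longleftrightarrow> (\<forall>x\<in>T ! j. \<forall>y\<in>T ! Suc j. x \<le> y)"
      if "Suc j < k" for j
      using that T fin[of j] fin[of "Suc j"] by (auto simp: Max_le_iff Min_ge_iff)
    show ?thesis
    proof
      assume *: "\<forall>j. Suc j < k \<longrightarrow> Max (T ! j) \<le> Min (T ! Suc j)"
      have "x \<le> y" if "Suc (a + d) < k" "x \<in> T ! a" "y \<in> T ! Suc (a + d)" for a d x y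
        using that
      proof (induction d arbitrary: y)
        case 0
        then show ?case using * adjacent by auto
      next
        case (Suc d)
        then obtain z where z: "z \<in> T ! Suc (a + d)" using T by (metis Suc_lessD add_Suc_right ex_in_conv)
        then have "x \<le> z" using Suc by simp
        moreover have "z \<le> y"
          using Suc.prems z * adjacent[of "Suc (a + d)"] by simp
        ultimately show ?case by simp
      qed
      then show "\<forall>a b x y. a < b \<longrightarrow> b < k \<longrightarrow> x \<in> T ! a \<longrightarrow> y \<in> T ! b \<longrightarrow> x \<le> y"
        by (metis less_imp_Suc_add)
    qed (use adjacent in blast)
  qed
  then show ?thesis unfolding SVT_def by blast
qed

lemma finite_SVT [simp]: "finite (SVT n k)"
proof (rule finite_subset)
  show "SVT n k \<subseteq> {T. set T \<subseteq> Pow {1..n} \<and> length T = k}"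
  proof
    fix T assume "T \<in> SVT n k"
    then show "T \<in> {T. set T \<subseteq> Pow {1..n} \<and> length T = k}"
      unfolding SVT_iff set_conv_nth by blast
  qed
  show "finite \<dots>" by (intro finite_lists_length_eq) simp
qed

lemma SVT_mono: "m \<le> n \<Longrightarrow> SVT m k \<subseteq> SVT n k"
  by (fastforce simp: SVT_iff)

lemma SVT_one: "SVT 1 k = {u_row k}"
proof -
  have "T = u_row k" if "T \<in> SVT 1 k" for T
  proof (rule nth_equalityI)
    fix b assume b: "b < length T"
    with that have "T ! b \<noteq> {}" "T ! b \<subseteq> {1}" by (auto simp: SVT_iff)
    then have "T ! b = {1}" by blast
    with b that show "T ! b = u_row k ! b" by (simp add: SVT_iff u_row_def)
  qed (use that in \<open>auto simp: SVT_iff u_row_def\<close>)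
  moreover have "u_row k \<in> SVT 1 k" by (auto simp: SVT_iff u_row_def)
  ultimately show ?thesis by blast
qed

lemma convex_below:
  assumes "\<And>a b c. a \<le> b \<Longrightarrow> b \<le> c \<Longrightarrow> c < k \<Longrightarrow> P a \<Longrightarrow> P c \<Longrightarrow> P b"
  shows "\<exists>r s. r \<le> s \<and> s \<le> k \<and> (\<forall>b<k. P b \<longleftrightarrow> r \<le> b \<and> b < (s::nat))"
proof (cases "\<exists>b<k. P b")
  case True
  let ?S = "{b. b < k \<and> P b}"
  have S: "finite ?S" "?S \<noteq> {}" using True by auto
  from Min_in[OF S] Max_in[OF S] have *: "P (Min ?S)" "Max ?S < k" "P (Max ?S)" by blast+
  have "P b \<longleftrightarrow> Min ?S \<le> b \<and> b < Suc (Max ?S)" if "b < k" for b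
  proof
    assume "P b"
    with that have "b \<in> ?S" by blast
    then show "Min ?S \<le> b \<and> b < Suc (Max ?S)"
      using Min_le[OF S(1)] Max_ge[OF S(1)] by (meson le_imp_less_Suc)
  next
    assume "Min ?S \<le> b \<and> b < Suc (Max ?S)"
    then show "P b" using assms[of "Min ?S" b "Max ?S"] * by linarith
  qed
  moreover have "Min ?S \<le> Suc (Max ?S)" using Max_ge[OF S(1) Min_in[OF S]] by linarith
  moreover have "Suc (Max ?S) \<le> k" using * by linarith
  ultimately show ?thesis by blast
next
  case False
  \<comment> \<open>The empty set is given the empty interval r = s = 0.\<close>
  then show ?thesis by (intro exI[of _ 0]) auto
qed

lemma filter_interval: "q \<le> k \<Longrightarrow> filter (\<lambda>b. r \<le> b \<and> b < q) [0..<k] = [r..<q]"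
proof (induction k arbitrary: q)
  case (Suc k)
  show ?case
  proof (cases "q = Suc k")
    case True
    have "filter (\<lambda>b. r \<le> b \<and> b < Suc k) [0..<k] = filter (\<lambda>b. r \<le> b \<and> b < k) [0..<k]"
      by (intro filter_cong) auto
    then show ?thesis using True Suc.IH[of k] by simp
  qed (use Suc in auto)
qed simp

lemma reduce_signature_sorted:
  "sorted_wrt (\<lambda>x y. \<not> (fst x = SMinus \<and> fst y = SPlus)) xs \<Longrightarrow> reduce_signature xs = xs"
  by (rule reduce_signature_irreducible) (auto simp: sorted_wrt_append elim!: delete_pair.cases)

section \<open>Strings\<close>

text \<open>A minus to the left of a plus would put i + 1 in a box strictly before one containing
  i.\<close>

lemma reduce_signature_SVT:
  assumes "T \<in> SVT n k"
  shows "reduce_signature (signature i T) = signature i T"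
proof (rule reduce_signature_sorted)
  let ?h = "\<lambda>b. if i \<in> T ! b \<and> Suc i \<notin> T ! b then [(SPlus, b)]
     else if Suc i \<in> T ! b \<and> i \<notin> T ! b then [(SMinus, b)] else []"
  let ?R = "\<lambda>x y. \<not> (fst x = SMinus \<and> fst y = SPlus)"
  have "sorted_wrt ?R (concat (map ?h [0..<m]))" if "m \<le> k" for m
    using that
  proof (induction m)
    case (Suc m)
    have "?R x y" if "x \<in> set (concat (map ?h [0..<m]))" "y \<in> set (?h m)" for x y
    proof
      assume xy: "fst x = SMinus \<and> fst y = SPlus"
      with that obtain a where "a < m" "Suc i \<in> T ! a" "i \<in> T ! m"
        by (auto split: if_splits)
      then have "Suc i \<le> i" using assms Suc.prems unfolding SVT_iff by (meson Suc_le_lessD)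
      then show False by simp
    qed
    moreover have "sorted_wrt ?R (?h m)" by auto
    ultimately show ?case using Suc by (simp only: upt_Suc_append le0 map_append concat_append
        sorted_wrt_append list.map concat.simps append_Nil2) auto
  qed simp
  then show "sorted_wrt ?R (signature i T)"
    using assms unfolding signature_def SVT_iff by blast
qed

lemma remaining_SVT:
  assumes "T \<in> SVT n k"
  shows "remaining SPlus i T = filter (\<lambda>b. i \<in> T ! b \<and> Suc i \<notin> T ! b) [0..<k]"
    and "remaining SMinus i T = filter (\<lambda>b. Suc i \<in> T ! b \<and> i \<notin> T ! b) [0..<k]"
proof -
  let ?h = "\<lambda>b. if i \<in> T ! b \<and> Suc i \<notin> T ! b then [(SPlus, b)]
     else if Suc i \<in> T ! b \<and> i \<notin> T ! b then [(SMinus, b)] else []"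
  have "map snd (filter (\<lambda>p. fst p = SPlus) (concat (map ?h bs))) =
        filter (\<lambda>b. i \<in> T ! b \<and> Suc i \<notin> T ! b) bs"
    and "map snd (filter (\<lambda>p. fst p = SMinus) (concat (map ?h bs))) =
        filter (\<lambda>b. Suc i \<in> T ! b \<and> i \<notin> T ! b) bs" for bs
    by (induction bs) auto
  then show "remaining SPlus i T = filter (\<lambda>b. i \<in> T ! b \<and> Suc i \<notin> T ! b) [0..<k]"
    and "remaining SMinus i T = filter (\<lambda>b. Suc i \<in> T ! b \<and> i \<notin> T ! b) [0..<k]"
    unfolding remaining_def reduce_signature_SVT[OF assms] unfolding signature_def
    using assms by (simp_all only: SVT_iff)
qed

text \<open>Candidate for the composite of the maximal powers of \<open>e_op i\<close> and
  \<open>eK_op i\<close>; \<open>down_SVT\<close> confirms it.\<close>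

definition down :: "nat \<Rightarrow> tableau \<Rightarrow> tableau" where
  "down i T = map ((`) (\<lambda>x. if x = Suc i then i else x)) T"

lemma length_down [simp]: "length (down i T) = length T"
  by (simp add: down_def)

lemma mem_down: "b < length T \<Longrightarrow>
   x \<in> down i T ! b \<longleftrightarrow> (x \<in> T ! b \<and> x \<noteq> Suc i) \<or> (x = i \<and> Suc i \<in> T ! b)"
  by (auto simp: down_def split: if_splits)

text \<open>The boxes of \<open>T\<close> meeting \<open>{i, i + 1}\<close> are those in positions \<open>r, \<dots>, s - 1\<close>.  They are refilled so
  that \<open>i + 1\<close> starts at position \<open>q\<close>; the box there also contains \<open>i\<close> if \<open>e = 1\<close>, and not if \<open>e = 0\<close>.\<close>

definition string_row :: "nat \<Rightarrow> tableau \<Rightarrow> nat \<Rightarrow> nat \<Rightarrow> nat \<Rightarrow> nat \<Rightarrow> tableau" where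
  "string_row i T r s q e = map (\<lambda>b. (T ! b - {i, Suc i}) \<union>
      (if r \<le> b \<and> b < q + e then {i} else {}) \<union> (if q \<le> b \<and> b < s then {Suc i} else {}))
    [0..<length T]"

text \<open>Fixes one string extended by the K-operators. Its members share the block of boxes
  meeting {i, i + 1} and all other entries; T supplies both.\<close>

locale i_string =
  fixes n k i :: nat and T :: tableau and r s :: nat
  assumes T: "T \<in> SVT n k" and i: "1 \<le> i" "i < n" and rs: "r \<le> s" "s \<le> k"
    and supp: "b < k \<Longrightarrow> i \<in> T ! b \<or> Suc i \<in> T ! b \<longleftrightarrow> r \<le> b \<and> b < s"
begin

definition row :: "nat \<Rightarrow> nat \<Rightarrow> tableau" where "row = string_row i T r s"

text \<open>With e = 0 the boundary q may equal s, meaning that i + 1 is absent; with e = 1 the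
  mixed box at q has to lie inside the block.\<close>

definition valid :: "nat \<Rightarrow> nat \<Rightarrow> bool" where "valid q e \<longleftrightarrow> r \<le> q \<and> q + e \<le> s \<and> e \<le> 1"

lemma validD: "valid q e \<Longrightarrow> r \<le> q \<and> q + e \<le> s \<and> e \<le> 1 \<and> s \<le> k"
  using rs by (simp add: valid_def)

lemma valid_top: "valid s 0" using rs by (simp add: valid_def)

lemma length_T: "length T = k" using T by (simp add: SVT_iff)

lemma length_row [simp]: "length (row q e) = k"
  by (simp add: row_def string_row_def length_T)

lemma row_nth: "b < k \<Longrightarrow> row q e ! b = (T ! b - {i, Suc i}) \<union>
      (if r \<le> b \<and> b < q + e then {i} else {}) \<union> (if q \<le> b \<and> b < s then {Suc i} else {})"
  by (simp add: row_def string_row_def length_T)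

lemma mem_row: "b < k \<Longrightarrow> x \<in> row q e ! b \<longleftrightarrow>
    (if x = i then r \<le> b \<and> b < q + e else if x = Suc i then q \<le> b \<and> b < s else x \<in> T ! b)"
  by (auto simp: row_nth)

lemma row_eqI:
  assumes "length S = k"
    and "\<And>b x. b < k \<Longrightarrow> x \<in> S ! b \<longleftrightarrow>
      (if x = i then r \<le> b \<and> b < q + e else if x = Suc i then q \<le> b \<and> b < s else x \<in> T ! b)"
  shows "S = row q e"
  using assms by (intro nth_equalityI set_eqI) (simp_all add: mem_row)

lemma row_SVT:
  assumes v: "valid q e"
  shows "row q e \<in> SVT n k"
  unfolding SVT_iff
proof (intro conjI allI impI)
  fix b assume b: "b < k"
  then have "T ! b \<noteq> {}" "T ! b \<subseteq> {1..n}" using T by (auto simp: SVT_iff)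
  then show "row q e ! b \<subseteq> {1..n}" using b i by (auto simp: row_nth)
  show "row q e ! b \<noteq> {}"
  proof (cases "r \<le> b \<and> b < s")
    case True
    then have "i \<in> row q e ! b \<or> Suc i \<in> row q e ! b" using b validD[OF v] by (auto simp: mem_row)
    then show ?thesis by blast
  next
    case False
    with supp[OF b] \<open>T ! b \<noteq> {}\<close> obtain x where "x \<in> T ! b" "x \<noteq> i" "x \<noteq> Suc i" by blast
    then have "x \<in> row q e ! b" using b by (simp add: mem_row)
    then show ?thesis by blast
  qed
next
  fix a b x y assume ab: "a < b" "b < k" and x: "x \<in> row q e ! a" and y: "y \<in> row q e ! b"
  have le: "x' \<le> y'" if "x' \<in> T ! a" "y' \<in> T ! b" for x' y'
    using that ab T by (auto simp: SVT_iff)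
  have special: "i \<in> T ! c \<or> Suc i \<in> T ! c" if "z \<in> row q e ! c" "z = i \<or> z = Suc i" "c < k" for c z
    using that supp[OF that(3)] validD[OF v] by (auto simp: mem_row split: if_splits)
  have plain: "z \<in> T ! c" if "z \<in> row q e ! c" "z \<noteq> i" "z \<noteq> Suc i" "c < k" for c z
    using that by (simp add: mem_row)
  have ak: "a < k" using ab by simp
  \<comment> \<open>Refilled boxes contain i or i + 1 only where T did, so the order in T compares
    these letters with all others. The one new danger is i + 1 before i, where q \<le> a < b < q + e
    contradicts e \<le> 1.\<close>
  consider "x \<noteq> i" "x \<noteq> Suc i" "y \<noteq> i" "y \<noteq> Suc i" | "x = i \<or> x = Suc i" "y \<noteq> i" "y \<noteq> Suc i"
    | "x \<noteq> i" "x \<noteq> Suc i" "y = i \<or> y = Suc i" | "x = i" "y = i \<or> y = Suc i"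
    | "x = Suc i" "y = Suc i" | "x = Suc i" "y = i" by blast
  then show "x \<le> y"
  proof cases
    case 1
    then show ?thesis using plain x y ab ak le by blast
  next
    case 2
    then have "i \<in> T ! a \<or> Suc i \<in> T ! a" "y \<in> T ! b" using special[OF x] plain[OF y] ak ab by auto
    then have "i \<le> y" using le by fastforce
    then show ?thesis using 2 by auto
  next
    case 3
    then have "i \<in> T ! b \<or> Suc i \<in> T ! b" "x \<in> T ! a" using special[OF y] plain[OF x] ak ab by auto
    then have "x \<le> Suc i" using le by fastforce
    then show ?thesis using 3 by auto
  next
    case 6
    then show ?thesis using x y ab ak validD[OF v] by (auto simp: mem_row)
  qed auto
qed simp

text \<open>A mixed box at q carries no sign: the pluses stop before q and the minuses start at q +
  e.\<close>

lemma remaining_row: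
  assumes v: "valid q e"
  shows "remaining SPlus i (row q e) = [r..<q]" "remaining SMinus i (row q e) = [q + e..<s]"
proof -
  note v' = validD[OF v]
  have "filter (\<lambda>b. i \<in> row q e ! b \<and> Suc i \<notin> row q e ! b) [0..<k] =
        filter (\<lambda>b. r \<le> b \<and> b < q) [0..<k]"
    using v' by (intro filter_cong) (auto simp: mem_row)
  also have "\<dots> = [r..<q]" using v' by (intro filter_interval) simp
  finally show "remaining SPlus i (row q e) = [r..<q]" by (simp add: remaining_SVT[OF row_SVT[OF v]])
  have "filter (\<lambda>b. Suc i \<in> row q e ! b \<and> i \<notin> row q e ! b) [0..<k] =
        filter (\<lambda>b. q + e \<le> b \<and> b < s) [0..<k]"
    using v' by (intro filter_cong) (auto simp: mem_row)
  also have "\<dots> = [q + e..<s]" using v' by (intro filter_interval) simp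
  finally show "remaining SMinus i (row q e) = [q + e..<s]"
    by (simp add: remaining_SVT[OF row_SVT[OF v]])
qed

section \<open>The operators along a string\<close>

lemma e_op_row_top: "valid q e \<Longrightarrow> q + e = s \<Longrightarrow> e_op i (row q e) = None"
  by (simp add: e_op_def remaining_row)

text \<open>The leftmost minus is at q + e. If e = 1, its left neighbour is the mixed box, which
  thereby moves one place to the right; if e = 0, the left neighbour, if any, lacks i + 1 and only
  the boundary moves.\<close>

lemma e_op_row:
  assumes v: "valid q e" and less: "q + e < s"
  shows "e_op i (row q e) = Some (row (Suc q) e)"
proof -
  note v' = validD[OF v]
  have ne: "remaining SMinus i (row q e) \<noteq> []" and hd: "hd (remaining SMinus i (row q e)) = q + e"
    using less by (simp_all add: remaining_row[OF v] upt_conv_Cons)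
  have cond: "0 < q + e \<and> Suc i \<in> row q e ! (q + e - 1) \<longleftrightarrow> e = 1"
    using v' less by (cases e) (auto simp: mem_row)
  show ?thesis
  proof (cases "e = 1")
    case True
    have "(row q e)[q := row q e ! q - {Suc i}, Suc q := insert i (row q e ! Suc q)] = row (Suc q) e"
      using v' less True by (intro row_eqI) (auto simp: nth_list_update mem_row)
    then show ?thesis unfolding e_op_def using ne hd cond True by (simp add: Let_def)
  next
    case False
    then have e: "e = 0" using v' by simp
    have "(row q e)[q := insert i (row q e ! q - {Suc i})] = row (Suc q) e"
      using v' less e by (intro row_eqI) (auto simp: nth_list_update mem_row)
    then show ?thesis unfolding e_op_def using ne hd cond e by (auto simp: Let_def)
  qed
qed

text \<open>Reverses the motion of \<open>e_op_row\<close>: the box after the rightmost plus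
  contains i exactly when it is the mixed box.\<close>

lemma f_op_row:
  assumes v: "valid (Suc q) e" "r \<le> q"
  shows "f_op i (row (Suc q) e) = Some (row q e)"
proof -
  note v' = validD[OF v(1)]
  have ne: "remaining SPlus i (row (Suc q) e) \<noteq> []" and last: "last (remaining SPlus i (row (Suc q) e)) = q"
    using v by (simp_all add: remaining_row[OF v(1)])
  have cond: "Suc q < k \<and> i \<in> row (Suc q) e ! Suc q \<longleftrightarrow> e = 1"
    using v' v(2) by (cases e) (auto simp: mem_row)
  show ?thesis
  proof (cases "e = 1")
    case True
    have "(row (Suc q) e)[Suc q := row (Suc q) e ! Suc q - {i}, q := insert (Suc i) (row (Suc q) e ! q)] = row q e"
      using v' v(2) True by (intro row_eqI) (auto simp: nth_list_update mem_row)
    then show ?thesis unfolding f_op_def using ne last cond True by (simp add: Let_def)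
  next
    case False
    then have e: "e = 0" using v' by simp
    have "(row (Suc q) e)[q := insert (Suc i) (row (Suc q) e ! q - {i})] = row q e"
      using v' v(2) e by (intro row_eqI) (auto simp: nth_list_update mem_row)
    then show ?thesis unfolding f_op_def using ne last cond e by (auto simp: Let_def)
  qed
qed

lemma eK_op_row_0: "valid q 0 \<Longrightarrow> eK_op i (row q 0) = None"
  by (auto simp: eK_op_def in_set_conv_nth mem_row)

lemma eK_op_row_1:
  assumes v: "valid q 1"
  shows "eK_op i (row q 1) = Some (row (Suc q) 0)"
proof -
  note v' = validD[OF v]
  have both: "b < k \<and> i \<in> row q 1 ! b \<and> Suc i \<in> row q 1 ! b \<longleftrightarrow> b = q" for b
    using v' by (auto simp: mem_row)
  then have "\<exists>A\<in>set (row q 1). i \<in> A \<and> Suc i \<in> A" by (metis length_row nth_mem)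
  moreover have "(THE b. b < length (row q 1) \<and> i \<in> row q 1 ! b \<and> Suc i \<in> row q 1 ! b) = q"
    using both by simp
  moreover have "(row q 1)[q := row q 1 ! q - {Suc i}] = row (Suc q) 0"
    using v' by (intro row_eqI) (auto simp: nth_list_update mem_row)
  ultimately show ?thesis by (simp add: eK_op_def)
qed

lemma fK_op_row:
  assumes "r < s"
  shows "fK_op i (row s 0) = Some (row (s - 1) 1)"
proof -
  have "{b. b < length (row s 0) \<and> i \<in> row s 0 ! b} = {r..<s}"
    using rs by (auto simp: mem_row)
  moreover have "Max {r..<s} = s - 1" using assms by (intro Max_eqI) auto
  moreover have "i \<in> row s 0 ! r" "r < k" using assms rs by (auto simp: mem_row)
  then have "\<exists>A\<in>set (row s 0). i \<in> A" by (metis length_row nth_mem)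
  moreover have "\<forall>A\<in>set (row s 0). Suc i \<notin> A" by (auto simp: in_set_conv_nth mem_row)
  moreover have "(row s 0)[s - 1 := insert (Suc i) (row s 0 ! (s - 1))] = row (s - 1) 1"
    using assms rs by (intro row_eqI) (auto simp: nth_list_update mem_row)
  ultimately show ?thesis by (auto simp: fK_op_def)
qed

text \<open>\<open>row s 0\<close> is the only member of the string without i + 1, that is, its
  top.\<close>

lemma down_row:
  assumes v: "valid q e"
  shows "down i (row q e) = row s 0"
  using validD[OF v] by (intro row_eqI) (auto simp: mem_down mem_row)

end

text \<open>\<open>None\<close> is absorbing under iteration, so the first failure determines the
  \<open>GREATEST\<close> exponent.\<close>

lemma op_max_eqI:
  assumes "op_pow g r T = Some S" "g S = None"
  shows "op_max g T = S"
proof -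
  have stop: "op_pow g (Suc r + d) T = None" for d
    by (induction d) (use assms in auto)
  have "(GREATEST r. op_pow g r T \<noteq> None) = r"
  proof (rule Greatest_equality)
    fix r' assume "op_pow g r' T \<noteq> None"
    then show "r' \<le> r" using stop[of "r' - Suc r"] by (cases "r' \<le> r") auto
  qed (use assms in simp)
  then show ?thesis using assms by (simp add: op_max_def)
qed

context i_string
begin

text \<open>\<open>e_op i\<close> keeps e and pushes the boundary to s - e; then
  \<open>eK_op i\<close> acts e times, turning a mixed box into {i} up to other entries.\<close>

lemma op_max_row:
  assumes v: "valid q e"
  shows "op_max (eK_op i) (op_max (e_op i) (row q e)) = row s 0"
proof -
  have "op_pow (e_op i) d (row q e) = Some (row (q + d) e)" if "q + d + e \<le> s" for d
    using that
  proof (induction d)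
    case (Suc d)
    then have "valid (q + d) e" "q + d + e < s" using v by (auto simp: valid_def)
    then show ?case using Suc e_op_row by simp
  qed simp
  from this[of "s - (q + e)"] have "op_pow (e_op i) (s - (q + e)) (row q e) = Some (row (s - e) e)"
    using validD[OF v] by simp
  moreover have top: "valid (s - e) e" "s - e + e = s" using v by (auto simp: valid_def)
  ultimately have e: "op_max (e_op i) (row q e) = row (s - e) e"
    using e_op_row_top by (intro op_max_eqI) auto
  have "e = 0 \<or> e = 1" using v by (auto simp: valid_def)
  then have "op_max (eK_op i) (row (s - e) e) = row s 0"
  proof
    assume "e = 0"
    then show ?thesis using eK_op_row_0[OF valid_top] by (intro op_max_eqI[of _ 0]) auto
  next
    assume "e = 1"
    then have "eK_op i (row (s - e) e) = Some (row s 0)" using eK_op_row_1 top by fastforce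
    then show ?thesis using eK_op_row_0[OF valid_top] by (intro op_max_eqI[of _ 1]) auto
  qed
  with e show ?thesis by simp
qed

text \<open>Descend from the top by at most one K-edge, which creates the mixed box, and then by
  \<open>f_op i\<close>, which moves the boundary left.\<close>

lemma row_connected:
  assumes v: "valid q e"
  shows "(row s 0, row q e) \<in> (crystal_edges n k)\<^sup>*"
proof -
  have f: "(row (q + d) e, row q e) \<in> (crystal_edges n k)\<^sup>*" if "q + d + e \<le> s" for d
    using that
  proof (induction d)
    case (Suc d)
    then have "valid (q + d) e" "valid (Suc (q + d)) e" "r \<le> q + d" using v by (auto simp: valid_def)
    then have "(row (q + Suc d) e, row (q + d) e) \<in> crystal_edges n k"
      using f_op_row[of "q + d" e] row_SVT i unfolding crystal_edges_def by fastforce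
    moreover have "(row (q + d) e, row q e) \<in> (crystal_edges n k)\<^sup>*" using Suc by simp
    ultimately show ?case by (rule converse_rtrancl_into_rtrancl)
  qed simp
  have top: "(row (s - e) e, row q e) \<in> (crystal_edges n k)\<^sup>*"
    using f[of "s - (q + e)"] validD[OF v] by simp
  have "e = 0 \<or> e = 1" using v by (auto simp: valid_def)
  then show ?thesis
  proof
    assume "e = 1"
    then have "valid (s - 1) 1" "r < s" using v by (auto simp: valid_def)
    then have "(row s 0, row (s - e) e) \<in> crystal_edges n k"
      using fK_op_row row_SVT[OF valid_top] row_SVT[of "s - 1" 1] i \<open>e = 1\<close>
      unfolding crystal_edges_def by fastforce
    from this top show ?thesis by (rule converse_rtrancl_into_rtrancl)
  qed (use top in simp)
qed

section \<open>Weights, excess and monomials along a string\<close>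

lemma wt_row:
  assumes v: "valid q e"
  shows "wt (row q e) i = q + e - r" "wt (row q e) (Suc i) = s - q"
    and "j \<noteq> i \<Longrightarrow> j \<noteq> Suc i \<Longrightarrow> wt (row q e) j = wt T j"
proof -
  have "{b. b < length (row q e) \<and> i \<in> row q e ! b} = {r..<q + e}"
    using validD[OF v] by (auto simp: mem_row)
  then show "wt (row q e) i = q + e - r" by (simp add: wt_def)
  have "{b. b < length (row q e) \<and> Suc i \<in> row q e ! b} = {q..<s}"
    using validD[OF v] by (auto simp: mem_row)
  then show "wt (row q e) (Suc i) = s - q" by (simp add: wt_def)
  show "wt (row q e) j = wt T j" if "j \<noteq> i" "j \<noteq> Suc i"
    using that unfolding wt_def by (intro arg_cong[of _ _ card]) (auto simp: mem_row length_T)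
qed

lemma ex_row:
  assumes v: "valid q e"
  shows "ex (row q e) = ex (row s 0) + e"
proof -
  note v' = validD[OF v]
  have "card (row q e ! b) - 1 = (card (row s 0 ! b) - 1) + (if b = q then e else 0)" if b: "b < k" for b
  proof -
    let ?D = "T ! b - {i, Suc i}"
    have "finite (T ! b)" using T b unfolding SVT_iff by (meson finite_subset finite_atLeastAtMost)
    then have "finite ?D" by simp
    moreover have "row s 0 ! b = (if r \<le> b \<and> b < s then insert i ?D else ?D)"
      using b by (auto simp: row_nth)
    moreover have "row q e ! b = (if r \<le> b \<and> b < s then
        if b < q then insert i ?D else if b = q \<and> e = 1 then insert i (insert (Suc i) ?D)
        else insert (Suc i) ?D else ?D)"
      using b v' by (auto simp: row_nth)
    ultimately show ?thesis using v' by (cases e) auto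
  qed
  then have "ex (row q e) = (\<Sum>b<k. (card (row s 0 ! b) - 1) + (if b = q then e else 0))"
    unfolding ex_def by (simp add: sum_list_sum_nth atLeast0LessThan)
  also have "\<dots> = ex (row s 0) + (if q < k then e else 0)"
    unfolding ex_def sum.distrib by (simp add: sum_list_sum_nth atLeast0LessThan)
  \<comment> \<open>If e = 1 then q < s \<le> k; if e = 0 both sides are 0.\<close>
  also have "(if q < k then e else 0) = e" using v' by auto
  finally show ?thesis .
qed

text \<open>The factor common to all monomials of the string. It is free of \<open>X i\<close> and
  \<open>X (Suc i)\<close>, hence a scalar for \<open>varpi_rel i\<close>.\<close>

definition rest :: mpoly where
  "rest = beta ^ ex (row s 0) * (\<Prod>j\<in>{1..n} - {i, Suc i}. X j ^ wt T j)"

lemma swap_rest: "swap_vars i rest = rest"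
proof -
  have "transpose i (Suc i) j = j" if "j \<in> {1..n} - {i, Suc i}" for j
    using that by (auto simp: transpose_def)
  then show ?thesis
    unfolding rest_def swap_vars_mult swap_vars_power swap_vars_prod swap_vars_X swap_vars_beta
    by (intro arg_cong2[of _ _ _ _ times] prod.cong) simp_all
qed

lemma monomial_row:
  assumes v: "valid q e"
  shows "tableau_monomial n (row q e) = rest * (beta ^ e * (X i ^ (q + e - r) * X (Suc i) ^ (s - q)))"
proof -
  let ?A = "{1..n} - {i, Suc i}" and ?f = "\<lambda>j. X j ^ wt (row q e) j"
  have "{1..n} = insert i (insert (Suc i) ?A)" using i by auto
  then have "prod ?f {1..n} = prod ?f (insert i (insert (Suc i) ?A))" by (rule arg_cong)
  also have "\<dots> = ?f i * (?f (Suc i) * prod ?f ?A)"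
    by (subst prod.insert, simp, simp, subst prod.insert) simp_all
  also have "\<dots> = X i ^ (q + e - r) * (X (Suc i) ^ (s - q) * prod ?f ?A)"
    by (simp only: wt_row[OF v])
  also have "(\<Prod>j\<in>{1..n} - {i, Suc i}. X j ^ wt (row q e) j) =
      (\<Prod>j\<in>{1..n} - {i, Suc i}. X j ^ wt T j)"
    by (intro prod.cong) (auto simp: wt_row[OF v])
  finally show ?thesis
    unfolding tableau_monomial_def rest_def ex_row[OF v] power_add by (simp only: mult_ac)
qed

lemma monomial_top: "tableau_monomial n (row s 0) = rest * X i ^ (s - r)"
  using monomial_row[OF valid_top] by simp

end

text \<open>A box strictly between two boxes meeting {i, i + 1} has all its entries in {i, i + 1},
  so these boxes form an interval. Within it the first i + 1 determines the filling.\<close>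

lemma ex_i_string:
  assumes T: "T \<in> SVT n k" and i: "1 \<le> i" "i < n"
  obtains r s q e where "i_string n k i T r s" "i_string.valid r s q e" "T = i_string.row i T r s q e"
proof -
  have order: "x \<le> y" if "a < b" "b < k" "x \<in> T ! a" "y \<in> T ! b" for a b x y
    using that T by (auto simp: SVT_iff)
  have convex: "i \<in> T ! b \<or> Suc i \<in> T ! b"
    if "a \<le> b" "b \<le> c" "c < k" "i \<in> T ! a \<or> Suc i \<in> T ! a" "i \<in> T ! c \<or> Suc i \<in> T ! c" for a b c
  proof (cases "a = b \<or> b = c")
    case False
    then have ab: "a < b" "b < c" "b < k" using that by auto
    then obtain z where z: "z \<in> T ! b" using T unfolding SVT_iff by blast
    from that(4) have "i \<le> z" using order[OF ab(1,3) _ z] Suc_leD by blast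
    from that(5) have "z \<le> Suc i" using order[OF ab(2) that(3) z] le_SucI by blast
    with \<open>i \<le> z\<close> have "z = i \<or> z = Suc i" by linarith
    with z show ?thesis by blast
  qed (use that in blast)
  have "\<exists>r s. r \<le> s \<and> s \<le> k \<and> (\<forall>b<k. i \<in> T ! b \<or> Suc i \<in> T ! b \<longleftrightarrow> r \<le> b \<and> b < s)"
    by (rule convex_below) (rule convex)
  then obtain r s where rs: "r \<le> s" "s \<le> k"
    and supp: "\<And>b. b < k \<Longrightarrow> i \<in> T ! b \<or> Suc i \<in> T ! b \<longleftrightarrow> r \<le> b \<and> b < s"
    by blast
  interpret i_string n k i T r s
    using T i rs supp by unfold_locales
  \<comment> \<open>The first box of the block containing i + 1; the alternative b = s keeps
    \<open>LEAST\<close> meaningful if there is none. Then e tells whether that box also contains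
    i.\<close>
  define q where "q = (LEAST b. r \<le> b \<and> (b = s \<or> Suc i \<in> T ! b))"
  have q: "r \<le> q \<and> (q = s \<or> Suc i \<in> T ! q)"
    unfolding q_def by (rule LeastI[of _ s]) (use rs in auto)
  have q_le: "q \<le> b" if "r \<le> b" "b = s \<or> Suc i \<in> T ! b" for b
    unfolding q_def using that by (intro Least_le) simp
  define e :: nat where "e = (if q < s \<and> i \<in> T ! q then 1 else 0)"
  have "q \<le> s" using q_le rs by simp
  have v: "valid q e" using q \<open>q \<le> s\<close> by (auto simp: valid_def e_def)
  have after: "i \<notin> T ! b" "Suc i \<in> T ! b" if "q < b" "b < s" for b
  proof -
    have bk: "b < k" "Suc i \<in> T ! q" using that q rs by auto
    show 1: "i \<notin> T ! b" using order[OF that(1) bk(1) bk(2)] by fastforce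
    show "Suc i \<in> T ! b" using supp[OF bk(1)] 1 that q by auto
  qed
  have before: "Suc i \<notin> T ! b" "i \<in> T ! b" if "r \<le> b" "b < q" for b
  proof -
    show 1: "Suc i \<notin> T ! b" using q_le[of b] that by auto
    show "i \<in> T ! b" using supp[of b] 1 that \<open>q \<le> s\<close> rs by auto
  qed
  have "T = row q e"
  proof (rule row_eqI)
    fix b x assume b: "b < k"
    have "i \<in> T ! b \<longleftrightarrow> r \<le> b \<and> b < q + e"
    proof (cases b q rule: linorder_cases)
      case less
      then show ?thesis using before[of b] supp[OF b] \<open>q \<le> s\<close> by auto
    next
      case equal
      then show ?thesis using supp[OF b] q by (auto simp: e_def)
    next
      case greater
      then show ?thesis using after[of b] supp[OF b] by (auto simp: e_def)
    qed
    moreover have "Suc i \<in> T ! b \<longleftrightarrow> q \<le> b \<and> b < s"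
    proof (cases b q rule: linorder_cases)
      case less
      then show ?thesis using before[of b] supp[OF b] by auto
    next
      case equal
      then show ?thesis using supp[OF b] q by auto
    next
      case greater
      then show ?thesis using after[of b] supp[OF b] by auto
    qed
    ultimately show "x \<in> T ! b \<longleftrightarrow> (if x = i then r \<le> b \<and> b < q + e
        else if x = Suc i then q \<le> b \<and> b < s else x \<in> T ! b)" by simp
  qed (rule length_T)
  then show ?thesis by (rule that[OF i_string_axioms v])
qed

lemma down_SVT:
  assumes "T \<in> SVT n k" "1 \<le> i" "i < n"
  shows "down i T \<in> SVT n k"
    and "op_max (eK_op i) (op_max (e_op i) T) = down i T"
    and "(down i T, T) \<in> (crystal_edges n k)\<^sup>*"
proof -
  obtain r s q e where *: "i_string n k i T r s" "i_string.valid r s q e" "T = i_string.row i T r s q e"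
    by (rule ex_i_string[OF assms])
  interpret i_string n k i T r s by fact
  have "down i T = row s 0" using down_row[OF *(2)] *(3)[symmetric] by simp
  then show "down i T \<in> SVT n k" "op_max (eK_op i) (op_max (e_op i) T) = down i T"
    "(down i T, T) \<in> (crystal_edges n k)\<^sup>*"
    using row_SVT[OF valid_top] op_max_row[OF *(2)] row_connected[OF *(2)] *(3)[symmetric] by simp_all
qed

text \<open>Within \<open>SVT n k\<close>, membership in \<open>SVT m k\<close> only bounds the
  entries by m. Lowering i + 1 to i affects this bound only when m = i.\<close>

lemma down_SVT_le:
  assumes "T \<in> SVT n k" "1 \<le> i" "i < n" "m \<le> n"
  shows "down i T \<in> SVT m k \<longleftrightarrow> T \<in> SVT (if m = i then Suc m else m) k"
proof -
  have *: "S \<in> SVT m' k \<longleftrightarrow> (\<forall>b<k. \<forall>x\<in>S ! b. x \<le> m')" if "S \<in> SVT n k" for S m'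
  proof -
    have "S ! b \<subseteq> {1..m'} \<longleftrightarrow> (\<forall>x\<in>S ! b. x \<le> m')" if "b < k" for b
    proof -
      have "S ! b \<subseteq> {1..n}" using \<open>S \<in> SVT n k\<close> that by (simp add: SVT_iff)
      then show ?thesis by fastforce
    qed
    with that show ?thesis unfolding SVT_iff by (simp add: all_conj_distrib)
  qed
  have "length T = k" using assms by (simp add: SVT_iff)
  moreover have "(if x = Suc i then i else x) \<le> m \<longleftrightarrow> x \<le> (if m = i then Suc m else m)" for x
    by auto
  ultimately have "(\<forall>x\<in>down i T ! b. x \<le> m) \<longleftrightarrow> (\<forall>x\<in>T ! b. x \<le> (if m = i then Suc m else m))"
    if "b < k" for b
    using that by (simp only: down_def nth_map ball_simps)
  then show ?thesis unfolding *[OF assms(1)] *[OF down_SVT(1)[OF assms(1-3)]] by blast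
qed

lemma down_idem: "\<forall>b<length T. Suc i \<notin> T ! b \<Longrightarrow> down i T = T"
  by (intro nth_equalityI set_eqI) (auto simp: mem_down)

text \<open>A row T without i + 1 is the top of its string, and the string is the whole fibre of
  \<open>down i\<close> over T. Here c is \<open>rest\<close> and t = s - r is the length of the
  block.\<close>

lemma fibre_sum:
  assumes T: "T \<in> SVT n k" and i: "1 \<le> i" "i < n" and no: "\<forall>b<k. Suc i \<notin> T ! b"
  shows "\<exists>c t. swap_vars i c = c \<and> tableau_monomial n T = c * X i ^ t \<and>
    (\<Sum>S | S \<in> SVT n k \<and> down i S = T. tableau_monomial n S) = c * string_poly i t"
proof -
  obtain r s q e where *: "i_string n k i T r s" "i_string.valid r s q e" "T = i_string.row i T r s q e"
    by (rule ex_i_string[OF T i])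
  interpret i_string n k i T r s by fact
  have top: "row s 0 = T"
    using down_idem[of T i] down_row[OF *(2)] *(3)[symmetric] no length_T by (metis)
  have fibre: "{S. S \<in> SVT n k \<and> down i S = T} =
      (\<lambda>q. row q 0) ` {r..s} \<union> (\<lambda>q. row q 1) ` {r..<s}" (is "?L = ?R")
  proof
    show "?L \<subseteq> ?R"
    proof
      fix S assume "S \<in> ?L"
      then have S: "S \<in> SVT n k" "down i S = T" by auto
      obtain r' s' p d where S': "i_string n k i S r' s'" "i_string.valid r' s' p d"
          "S = i_string.row i S r' s' p d"
        by (rule ex_i_string[OF S(1) i])
      interpret S: i_string n k i S r' s' by fact
      \<comment> \<open>\<open>down i\<close> preserves which boxes meet {i, i + 1}, so S and T have
        the same block.\<close>
      have supp': "r \<le> b \<and> b < s \<longleftrightarrow> r' \<le> b \<and> b < s'" if "b < k" for b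
        using that S(2) mem_down[of b S i i] S.length_T supp[of b] S.supp[of b] no by auto
      have other: "x \<in> S ! b \<longleftrightarrow> x \<in> T ! b" if "b < k" "x \<noteq> i" "x \<noteq> Suc i" for b x
        using that S(2) mem_down[of b S x i] S.length_T by auto
      \<comment> \<open>Equal intervals have equal endpoints only when nonempty, so an empty block
        is treated separately.\<close>
      show "S \<in> ?R"
      proof (cases "r = s")
        case True
        have none: "i \<notin> S ! b" "Suc i \<notin> S ! b" if "b < k" for b
          using S.supp[OF that] supp'[OF that] True by auto
        have "S = row s 0"
          by (rule row_eqI) (use none other True S.length_T in auto)
        then show ?thesis using True by auto
      next
        case False
        then have "r < s" using rs by simp
        have sub: "r' \<le> b \<and> b < s'" if "r \<le> b" "b < s" for b
          using supp'[of b] that rs by auto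
        have sub': "r \<le> b \<and> b < s" if "r' \<le> b" "b < s'" for b
          using supp'[of b] that S.rs by auto
        have "r \<le> s - 1" "s - 1 < s" using \<open>r < s\<close> by linarith+
        from sub[OF this] sub[OF le_refl \<open>r < s\<close>] have 1: "s \<le> s'" "r' \<le> r" "r' < s'" by linarith+
        then have "r' \<le> s' - 1" "s' - 1 < s'" by linarith+
        from sub'[OF this] sub'[OF le_refl 1(3)] 1 have "r' = r" "s' = s" by linarith+
        have "x \<in> S ! b \<longleftrightarrow> x \<in> S.row p d ! b" for b x using S'(3) by (rule arg_cong)
        then have "S = row p d"
          using S.mem_row other \<open>r' = r\<close> \<open>s' = s\<close> by (intro row_eqI S.length_T) metis
        moreover have "valid p d" using S'(2) \<open>r' = r\<close> \<open>s' = s\<close> unfolding valid_def S.valid_def by simp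
        moreover from this have "d = 0 \<or> d = 1" by (auto simp: valid_def)
        ultimately show ?thesis by (auto simp: valid_def)
      qed
    qed
    show "?R \<subseteq> ?L"
    proof -
      have "row q e \<in> ?L" if "valid q e" for q e
        using row_SVT[OF that] down_row[OF that] top by simp
      moreover have "valid q 0" if "q \<in> {r..s}" for q using that by (simp add: valid_def)
      moreover have "valid q 1" if "q \<in> {r..<s}" for q using that by (simp add: valid_def)
      ultimately show ?thesis by blast
    qed
  qed
  \<comment> \<open>The multiplicities of i + 1 and i recover q and then e.\<close>
  have inj: "q = q' \<and> e = e'" if "row q e = row q' e'" "valid q e" "valid q' e'" for q e q' e'
  proof -
    have "s - q = s - q'" "q + e - r = q' + e' - r"
      using wt_row(1,2)[OF that(2)] wt_row(1,2)[OF that(3)] that(1) by simp_all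
    then show ?thesis using that(2,3) unfolding valid_def by linarith
  qed
  have "(\<Sum>S | S \<in> SVT n k \<and> down i S = T. tableau_monomial n S) =
      (\<Sum>q\<in>{r..s}. tableau_monomial n (row q 0)) + (\<Sum>q\<in>{r..<s}. tableau_monomial n (row q 1))"
  proof -
    have "(\<lambda>q. row q 0) ` {r..s} \<inter> (\<lambda>q. row q 1) ` {r..<s} = {}"
    proof -
      have "row q 0 \<noteq> row q' 1" if "q \<in> {r..s}" "q' \<in> {r..<s}" for q q'
        using inj[of q 0 q' 1] that by (auto simp: valid_def)
      then show ?thesis by blast
    qed
    moreover have "inj_on (\<lambda>q. row q 0) {r..s}"
      using inj[of _ 0 _ 0] by (intro inj_onI) (simp add: valid_def)
    moreover have "inj_on (\<lambda>q. row q 1) {r..<s}"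
      using inj[of _ 1 _ 1] by (intro inj_onI) (simp add: valid_def)
    ultimately show ?thesis
      unfolding fibre by (simp add: sum.union_disjoint sum.reindex)
  qed
  also have "\<dots> = rest * (\<Sum>q\<in>{r..s}. X i ^ (q - r) * X (Suc i) ^ (s - q)) +
      rest * (beta * (\<Sum>q\<in>{r..<s}. X i ^ (q + 1 - r) * X (Suc i) ^ (s - q)))"
    unfolding sum_distrib_left
    by (intro arg_cong2[of _ _ _ _ plus] sum.cong refl) (subst monomial_row; simp add: valid_def)+
  \<comment> \<open>Substituting a = q - r turns boundary positions into the indices of
    \<open>string_poly\<close>.\<close>
  also have "(\<Sum>q\<in>{r..s}. X i ^ (q - r) * X (Suc i) ^ (s - q)) =
      (\<Sum>a\<le>s - r. X i ^ a * X (Suc i) ^ (s - r - a))"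
    using rs by (intro sum.reindex_bij_witness[of _ "\<lambda>a. a + r" "\<lambda>q. q - r"]) auto
  also have "(\<Sum>q\<in>{r..<s}. X i ^ (q + 1 - r) * X (Suc i) ^ (s - q)) =
      (\<Sum>a<s - r. X i ^ Suc a * X (Suc i) ^ (s - r - a))"
    using rs by (intro sum.reindex_bij_witness[of _ "\<lambda>a. a + r" "\<lambda>q. q - r"]) (auto simp: Suc_diff_le)
  finally have "(\<Sum>S | S \<in> SVT n k \<and> down i S = T. tableau_monomial n S) = rest * string_poly i (s - r)"
    by (simp only: string_poly_def distrib_left)
  with swap_rest monomial_top show ?thesis unfolding top by blast
qed

section \<open>Generating functions\<close>

text \<open>B is the disjoint union of the strings with top in A. Each string sum is symmetric and
  is related by \<open>varpi_rel i\<close> to the monomial of its top; both facts survive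
  summation.\<close>

lemma varpi_fibres:
  assumes i: "1 \<le> i" "i < n" and A: "A \<subseteq> {T \<in> SVT n k. \<forall>b<k. Suc i \<notin> T ! b}"
  defines "B \<equiv> {S \<in> SVT n k. down i S \<in> A}"
  shows "varpi_rel i (\<Sum>T\<in>A. tableau_monomial n T) (\<Sum>S\<in>B. tableau_monomial n S)"
    and "swap_vars i (\<Sum>S\<in>B. tableau_monomial n S) = (\<Sum>S\<in>B. tableau_monomial n S)"
proof -
  let ?fibre = "\<lambda>T. \<Sum>S | S \<in> SVT n k \<and> down i S = T. tableau_monomial n S"
  have "finite A" by (rule finite_subset[OF A]) simp
  then have "(\<Sum>T\<in>A. \<Sum>S\<in>{S \<in> B. down i S = T}. tableau_monomial n S) = (\<Sum>S\<in>B. tableau_monomial n S)"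
    by (intro sum.group) (auto simp: B_def)
  moreover have "{S \<in> B. down i S = T} = {S. S \<in> SVT n k \<and> down i S = T}" if "T \<in> A" for T
    using that by (auto simp: B_def)
  ultimately have B: "(\<Sum>S\<in>B. tableau_monomial n S) = (\<Sum>T\<in>A. ?fibre T)"
    by simp
  have fibre: "varpi_rel i (tableau_monomial n T) (?fibre T)" "swap_vars i (?fibre T) = ?fibre T"
    if "T \<in> A" for T
  proof -
    obtain c t where c: "swap_vars i c = c" and T: "tableau_monomial n T = c * X i ^ t"
      and sum: "?fibre T = c * string_poly i t"
      using fibre_sum[of T n k i] i A \<open>T \<in> A\<close> by blast
    show "varpi_rel i (tableau_monomial n T) (?fibre T)"
      unfolding T sum by (intro varpi_rel_mult varpi_rel_power c)
    show "swap_vars i (?fibre T) = ?fibre T"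
      unfolding sum swap_vars_mult c swap_string_poly ..
  qed
  show "varpi_rel i (\<Sum>T\<in>A. tableau_monomial n T) (\<Sum>S\<in>B. tableau_monomial n S)"
    unfolding B by (intro varpi_rel_sum fibre)
  show "swap_vars i (\<Sum>S\<in>B. tableau_monomial n S) = (\<Sum>S\<in>B. tableau_monomial n S)"
    unfolding B by (subst swap_vars_sum) (intro sum.cong refl fibre)
qed

text \<open>If m \<le> i, all rows in \<open>SVT m k\<close> are tops and their strings fill the
  target set. If m > i, \<open>SVT m k\<close> is already a union of full strings, so its sum is
  symmetric and fixed.\<close>

lemma varpi_SVT:
  assumes i: "1 \<le> i" "i < n" and m: "m \<le> n"
  shows "varpi i (\<Sum>T\<in>SVT m k. tableau_monomial n T) =
    (\<Sum>T\<in>SVT (if m = i then Suc m else m) k. tableau_monomial n T)"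
proof (cases "m \<le> i")
  case True
  have "SVT m k \<subseteq> {T \<in> SVT n k. \<forall>b<k. Suc i \<notin> T ! b}"
  proof
    fix T assume T: "T \<in> SVT m k"
    then have "T ! b \<subseteq> {1..m}" if "b < k" for b using that by (simp add: SVT_iff)
    then have "\<forall>b<k. Suc i \<notin> T ! b" using True by fastforce
    with T SVT_mono[OF m] show "T \<in> {T \<in> SVT n k. \<forall>b<k. Suc i \<notin> T ! b}" by blast
  qed
  moreover have "{S \<in> SVT n k. down i S \<in> SVT m k} = SVT (if m = i then Suc m else m) k"
  proof -
    have "SVT (if m = i then Suc m else m) k \<subseteq> SVT n k" using i m by (intro SVT_mono) auto
    then show ?thesis using down_SVT_le[OF _ i m] by blast
  qed
  ultimately show ?thesis using varpi_fibres(1)[OF i, of "SVT m k" k] by (simp only: varpi_eqI)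
next
  case False
  let ?A = "{T \<in> SVT m k. \<forall>b<k. Suc i \<notin> T ! b}"
  have "down i S \<in> ?A \<longleftrightarrow> S \<in> SVT m k" if S: "S \<in> SVT n k" for S
  proof -
    have "length S = k" using S by (simp add: SVT_iff)
    then have "\<forall>b<k. Suc i \<notin> down i S ! b" by (simp add: mem_down)
    then show ?thesis using down_SVT_le[OF S i m] False by simp
  qed
  then have B: "{S \<in> SVT n k. down i S \<in> ?A} = SVT m k"
    using SVT_mono[OF m] by blast
  have "?A \<subseteq> {T \<in> SVT n k. \<forall>b<k. Suc i \<notin> T ! b}" using SVT_mono[OF m] by blast
  from varpi_fibres(2)[OF i this] show ?thesis
    unfolding B using False by (simp add: varpi_eqI varpi_rel_self)
qed

text \<open>The value at 1 of the product of the word in the 0-Hecke monoid; it is \<open>w(1)\<close> for a reduced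
  expression of \<open>w\<close> (lemma \<open>level_reduced\<close> below).\<close>

definition level :: "nat list \<Rightarrow> nat" where
  "level ws = foldr (\<lambda>i m. if m = i then Suc m else m) ws 1"

lemma level_Nil [simp]: "level [] = 1"
  and level_Cons [simp]: "level (i # ws) = (if level ws = i then Suc (level ws) else level ws)"
  by (simp_all add: level_def)

lemma level_le: "n \<ge> 1 \<Longrightarrow> set ws \<subseteq> {1..<n} \<Longrightarrow> level ws \<le> n"
  by (induction ws) auto

section \<open>K-Demazure crystals and their generating functions\<close>

lemma fold_SVT:
  assumes "set ws \<subseteq> {1..<n}" "T \<in> SVT n k"
  shows "fold (\<lambda>i S. op_max (eK_op i) (op_max (e_op i) S)) ws T = fold down ws T"
  using assms by (induction ws arbitrary: T) (simp_all add: down_SVT)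

text \<open>\<open>fold\<close> applies the first letter first, so prepending i replaces the
  condition on T by the same condition on \<open>down i T\<close>; by \<open>down_SVT_le\<close>
  this is the recursion of \<open>level\<close>.\<close>

lemma K_Demazure_eq_SVT:
  assumes "n \<ge> 1" "set ws \<subseteq> {1..<n}"
  shows "K_Demazure n k ws = SVT (level ws) k"
proof -
  have "{T \<in> SVT n k. fold down ws T = u_row k} = SVT (level ws) k"
    using assms(2)
  proof (induction ws)
    case Nil
    have "u_row k \<in> SVT n k" using SVT_mono[OF assms(1)] SVT_one[of k] by blast
    then show ?case using SVT_one[of k] by auto
  next
    case (Cons i ws)
    then have i: "1 \<le> i" "i < n" and ws: "set ws \<subseteq> {1..<n}" by auto
    note le = level_le[OF assms(1) ws]
    have "fold down (i # ws) T = u_row k \<longleftrightarrow> T \<in> SVT (level (i # ws)) k" if T: "T \<in> SVT n k" for T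
    proof -
      have "fold down (i # ws) T = u_row k \<longleftrightarrow> down i T \<in> SVT (level ws) k"
        using Cons.IH[OF ws] down_SVT(1)[OF T i] by auto
      then show ?thesis using down_SVT_le[OF T i le] by simp
    qed
    moreover have "SVT (level (i # ws)) k \<subseteq> SVT n k"
      by (intro SVT_mono level_le assms Cons.prems)
    ultimately show ?case by blast
  qed
  moreover have "K_Demazure n k ws = {T \<in> SVT n k. fold down ws T = u_row k}"
    unfolding K_Demazure_def using fold_SVT[OF assms(2)] by auto
  ultimately show ?thesis by simp
qed

lemma monomial_u_row: "n \<ge> 1 \<Longrightarrow> tableau_monomial n (u_row k) = X 1 ^ k"
proof -
  assume n: "n \<ge> 1"
  have wt: "wt (u_row k) j = (if j = 1 then k else 0)" for j
  proof -
    have "{b. b < length (u_row k) \<and> j \<in> u_row k ! b} = (if j = 1 then {..<k} else {})"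
      by (auto simp: u_row_def)
    then show ?thesis by (simp add: wt_def)
  qed
  have "(\<Prod>j=1..n. X j ^ wt (u_row k) j) = (\<Prod>j=1..n. if j = 1 then X 1 ^ k else 1)"
    by (intro prod.cong) (auto simp: wt)
  moreover have "ex (u_row k) = 0" by (simp add: ex_def u_row_def sum_list_replicate)
  ultimately show ?thesis using n by (simp add: tableau_monomial_def)
qed

text \<open>Starting from the single row \<open>u_row k\<close>, each \<open>varpi i\<close> changes
  the bound on entries by the recursion of \<open>level\<close>.\<close>

lemma sum_SVT_level:
  assumes "n \<ge> 1" "set ws \<subseteq> {1..<n}"
  shows "(\<Sum>T\<in>SVT (level ws) k. tableau_monomial n T) = foldr varpi ws (X 1 ^ k)"
  using assms(2)
proof (induction ws)
  case Nil
  then show ?case using monomial_u_row[OF assms(1)] SVT_one[of k] by simp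
next
  case (Cons i ws)
  then have "1 \<le> i" "i < n" "level ws \<le> n" using level_le[OF assms(1), of ws] by auto
  from varpi_SVT[OF this, of k] Cons show ?case by simp
qed

section \<open>Reduced expressions\<close>

lemma word_perm_Cons: "word_perm (i # ws) = transpose i (Suc i) \<circ> word_perm ws"
  by (simp add: word_perm_def)

lemma inj_word_perm: "inj (word_perm ws)"
proof (induction ws)
  case (Cons i ws)
  then show ?case unfolding word_perm_Cons by (intro inj_compose) simp_all
qed (simp add: word_perm_def)

lemma word_perm_permutes: "set ws \<subseteq> {1..<n} \<Longrightarrow> word_perm ws permutes {1..n}"
proof (induction ws)
  case (Cons i ws)
  then show ?case unfolding word_perm_Cons
    by (intro permutes_compose permutes_swap_id) auto
qed (simp add: word_perm_def permutes_id)

text \<open>Conjugation trades a transposition of positions for one of values.\<close>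

lemma word_perm_transpose:
  "word_perm ws \<circ> transpose a b = transpose (word_perm ws a) (word_perm ws b) \<circ> word_perm ws"
  by (rule ext) (auto simp: transpose_def inj_eq[OF inj_word_perm])

text \<open>Follow \<open>a\<close> and \<open>b\<close> through the word: the letter at which their images change order can be
  deleted.\<close>

lemma inversion_shortens:
  assumes "a < b" "word_perm ws a > word_perm ws b"
  shows "\<exists>vs. set vs \<subseteq> set ws \<and> Suc (length vs) = length ws \<and>
    word_perm vs = word_perm ws \<circ> transpose a b"
  using assms(2)
proof (induction ws)
  case Nil
  then show ?case using assms(1) by (simp add: word_perm_def)
next
  case (Cons i ws)
  show ?case
  proof (cases "word_perm ws a > word_perm ws b")
    case True
    from Cons.IH[OF this] obtain vs where "set vs \<subseteq> set ws" "Suc (length vs) = length ws"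
      "word_perm vs = word_perm ws \<circ> transpose a b" by blast
    then show ?thesis by (intro exI[of _ "i # vs"]) (auto simp: word_perm_Cons comp_assoc)
  next
    case False
    moreover have "word_perm ws a \<noteq> word_perm ws b"
      using assms(1) by (simp add: inj_eq[OF inj_word_perm])
    ultimately have "word_perm ws a = i" "word_perm ws b = Suc i"
      using Cons.prems by (auto simp: word_perm_Cons transpose_def split: if_splits)
    then have "word_perm (i # ws) \<circ> transpose a b = word_perm ws"
      unfolding word_perm_Cons comp_assoc word_perm_transpose
      by (simp add: fun_eq_iff)
    then show ?thesis by (intro exI[of _ ws]) auto
  qed
qed

text \<open>A shorter word for the tail would shorten the whole word.\<close>

lemma reduced_expr_tl:
  assumes "reduced_expr n (word_perm (i # ws)) (i # ws)"
  shows "reduced_expr n (word_perm ws) ws"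
  unfolding reduced_expr_def
proof (intro conjI allI impI)
  fix vs assume "set vs \<subseteq> {1..<n} \<and> word_perm vs = word_perm ws"
  then have "set (i # vs) \<subseteq> {1..<n} \<and> word_perm (i # vs) = word_perm (i # ws)"
    using assms by (auto simp: reduced_expr_def word_perm_Cons)
  then have "length (i # ws) \<le> length (i # vs)"
    using assms unfolding reduced_expr_def by blast
  then show "length ws \<le> length vs" by simp
qed (use assms in \<open>auto simp: reduced_expr_def\<close>)

text \<open>The recursions of \<open>level\<close> and of the image of 1 differ only when the tail
  sends 1 to i + 1, since then the letter i lowers it to i. Reducedness excludes this.\<close>

lemma level_reduced: "reduced_expr n (word_perm ws) ws \<Longrightarrow> level ws = word_perm ws 1"
proof (induction ws)
  case Nil
  then show ?case by (simp add: word_perm_def)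
next
  case (Cons i ws)
  note red = reduced_expr_tl[OF Cons.prems]
  have "level ws = word_perm ws 1" using Cons.IH[OF red] .
  moreover have "word_perm ws 1 \<noteq> Suc i"
  proof
    assume 1: "word_perm ws 1 = Suc i"
    have i: "1 \<le> i" "i < n" and ws: "set ws \<subseteq> {1..<n}"
      using Cons.prems by (auto simp: reduced_expr_def)
    then obtain b where b: "b \<in> {1..n}" "word_perm ws b = i"
      using permutes_image[OF word_perm_permutes[OF ws]]
      by (metis atLeastAtMost_iff imageE less_imp_le_nat)
    then have "b \<noteq> 1" using 1 by auto
    then have "1 < b" using b by auto
    with 1 b obtain vs where vs: "set vs \<subseteq> set ws" "Suc (length vs) = length ws"
      "word_perm vs = word_perm ws \<circ> transpose 1 b"
      using inversion_shortens[of 1 b ws] by auto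
    \<comment> \<open>The tail sends 1 and b to i + 1 and i, so swapping 1 and b first equals
      applying the letter i afterwards. Thus vs, two letters shorter, represents the same
      permutation.\<close>
    then have "word_perm vs = word_perm (i # ws)"
      unfolding word_perm_transpose 1 b word_perm_Cons by (simp add: transpose_commute)
    then have "length (i # ws) \<le> length vs"
      using Cons.prems vs(1) ws unfolding reduced_expr_def by blast
    then show False using vs(2) by simp
  qed
  ultimately show ?case by (simp add: word_perm_Cons transpose_def)
qed

section \<open>Connectedness and the highest weight element\<close>

text \<open>Induction on the bound m for the entries: \<open>down m\<close> lowers the bound by one
  and stays within the string, which is reachable from its top.\<close>

lemma connected_to_u:
  assumes "m \<ge> 1" "m \<le> n" "T \<in> SVT m k"
  shows "(u_row k, T) \<in> (crystal_edges n k)\<^sup>*"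
  using assms
proof (induction m arbitrary: T rule: dec_induct)
  case base
  then show ?case using SVT_one[of k] by simp
next
  case (step m)
  then have "T \<in> SVT n k" "1 \<le> m" "m < n" using SVT_mono[of "Suc m" n k] by auto
  note down = down_SVT(3)[OF this] down_SVT_le[OF this, of m]
  have "down m T \<in> SVT m k" using down(2) step.prems by simp
  then have "(u_row k, down m T) \<in> (crystal_edges n k)\<^sup>*" using step by simp
  then show ?case using down(1) by (rule rtrancl_trans)
qed

text \<open>Vanishing of \<open>e_op i\<close> excludes boxes with i + 1 but not i, and vanishing of
  \<open>eK_op i\<close> those with both. Hence no entry exceeds 1.\<close>

lemma highest_weight:
  assumes T: "T \<in> SVT n k" and n: "n \<ge> 1"
    and none: "\<forall>i\<in>{1..<n}. e_op i T = None \<and> eK_op i T = None"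
  shows "T = u_row k"
proof -
  have no: "Suc i \<notin> T ! b" if i: "i \<in> {1..<n}" and b: "b < k" for i b
  proof -
    have "remaining SMinus i T = []"
      using none i by (auto simp: e_op_def Let_def split: if_splits)
    then have "\<not> (Suc i \<in> T ! b \<and> i \<notin> T ! b)"
      using b unfolding remaining_SVT[OF T] by (simp add: filter_empty_conv)
    moreover have "\<forall>A\<in>set T. \<not> (i \<in> A \<and> Suc i \<in> A)"
      using none i by (auto simp: eK_op_def Let_def split: if_splits)
    then have "\<not> (i \<in> T ! b \<and> Suc i \<in> T ! b)"
      using b T unfolding SVT_iff by (metis nth_mem)
    ultimately show ?thesis by blast
  qed
  have "T \<in> SVT 1 k"
    unfolding SVT_iff
  proof (intro conjI allI impI)
    fix b assume b: "b < k"
    show "T ! b \<subseteq> {1..1}"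
    proof
      fix x assume x: "x \<in> T ! b"
      moreover have "T ! b \<subseteq> {1..n}" using T b by (simp add: SVT_iff)
      ultimately have "x \<in> {1..n}" by blast
      show "x \<in> {1..1}"
      proof (rule ccontr)
        assume "x \<notin> {1..1}"
        with \<open>x \<in> {1..n}\<close> obtain i where "x = Suc i" "i \<in> {1..<n}"
          by (cases x) auto
        with no[OF _ b] x show False by blast
      qed
    qed
  qed (use T in \<open>auto simp: SVT_iff\<close>)
  then show ?thesis using SVT_one[of k] by blast
qed

lemma u_row_highest:
  assumes "1 \<le> i"
  shows "e_op i (u_row k) = None" and "eK_op i (u_row k) = None"
proof -
  have "u_row k \<in> SVT 1 k" using SVT_one[of k] by blast
  from remaining_SVT(2)[OF this, of i] have "remaining SMinus i (u_row k) = []"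
    using assms by (auto simp: filter_empty_conv u_row_def)
  then show "e_op i (u_row k) = None" by (simp add: e_op_def)
  show "eK_op i (u_row k) = None" using assms by (auto simp: eK_op_def u_row_def)
qed

theorem theorem7p5:
  fixes n k :: nat
  assumes "n \<ge> 2" and "k \<ge> 1"
  shows
    "(\<forall>S\<in>SVT n k. \<forall>T\<in>SVT n k. (S, T) \<in> (crystal_edges n k \<union> (crystal_edges n k)\<inverse>)\<^sup>*) \<and>
     {T \<in> SVT n k. \<forall>i\<in>{1..<n}. e_op i T = None \<and> eK_op i T = None} = {u_row k} \<and>
     (\<forall>w ws ws'. w permutes {1..n} \<and> reduced_expr n w ws \<and> reduced_expr n w ws' \<longrightarrow>
        K_Demazure n k ws = K_Demazure n k ws') \<and>
     (\<forall>w ws. w permutes {1..n} \<and> reduced_expr n w ws \<longrightarrow>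
        (\<Sum>T\<in>K_Demazure n k ws. tableau_monomial n T) = foldr varpi ws (X 1 ^ k))"
proof -
  have n: "n \<ge> 1" using assms by simp
  let ?E = "crystal_edges n k"
  have "(S, T) \<in> (?E \<union> ?E\<inverse>)\<^sup>*" if S: "S \<in> SVT n k" and T: "T \<in> SVT n k" for S T
  proof -
    have "(u_row k, S) \<in> (?E \<union> ?E\<inverse>)\<^sup>*" "(u_row k, T) \<in> (?E \<union> ?E\<inverse>)\<^sup>*"
      using connected_to_u[OF n le_refl S] connected_to_u[OF n le_refl T]
      by (meson in_rtrancl_UnI)+
    moreover have "sym ((?E \<union> ?E\<inverse>)\<^sup>*)" by (intro sym_rtrancl sym_Un_converse)
    ultimately show ?thesis by (meson rtrancl_trans symD)
  qed
  moreover have "{T \<in> SVT n k. \<forall>i\<in>{1..<n}. e_op i T = None \<and> eK_op i T = None} = {u_row k}"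
  proof (intro equalityI subsetI)
    fix T assume "T \<in> {T \<in> SVT n k. \<forall>i\<in>{1..<n}. e_op i T = None \<and> eK_op i T = None}"
    then show "T \<in> {u_row k}" using highest_weight[OF _ n, of T k] by blast
  next
    have "u_row k \<in> SVT n k" using SVT_mono[OF n, of k] unfolding SVT_one by simp
    moreover fix T assume "T \<in> {u_row k}"
    ultimately show "T \<in> {T \<in> SVT n k. \<forall>i\<in>{1..<n}. e_op i T = None \<and> eK_op i T = None}"
      using u_row_highest[of _ k] by simp
  qed
  \<comment> \<open>The crystal depends on w only through w(1), which gives independence of the
    reduced expression.\<close>
  moreover have "K_Demazure n k ws = SVT (w 1) k" if "reduced_expr n w ws" for w ws
  proof -
    have "set ws \<subseteq> {1..<n}" "word_perm ws = w" using that by (auto simp: reduced_expr_def)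
    with that level_reduced[of n ws] show ?thesis by (simp add: K_Demazure_eq_SVT[OF n])
  qed
  moreover have "(\<Sum>T\<in>K_Demazure n k ws. tableau_monomial n T) = foldr varpi ws (X 1 ^ k)"
    if "reduced_expr n w ws" for w ws
  proof -
    have "set ws \<subseteq> {1..<n}" using that by (simp add: reduced_expr_def)
    then show ?thesis by (simp only: K_Demazure_eq_SVT[OF n] sum_SVT_level[OF n])
  qed
  ultimately show ?thesis by auto
qed

end
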